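(* Let $F$ be a formula, $\mathcal{S}$ a set of solving strategies, $N\in\mathbb{N}$, and $\mathcal{C}$ a finite set of cubes such that $\bigvee_{c\in\mathcal{C}}(F\wedge c)$ and $F$ are equi-satisfiable. Suppose the procedure $\mathrm{Cube}$ is sound, i.e. for every formula $G$ and $k>1$, $G$ and $\bigvee_{c\in\mathrm{Cube}(G,k)}(G\wedge c)$ are equi-satisfiable. Then, for the procedure $\mathrm{Collect}$ described in the context, $F$ is satisfiable if $\mathrm{Collect}(F,\mathcal{C},N,\mathcal{S})$ returns $\langle\mathrm{SAT},\emptyset\rangle$, and $F$ is unsatisfiable if it returns $\langle\mathrm{UNSAT},\emptyset\rangle$.
   Context: A cube is a conjunction of literals (constraints). For a formula $F$, a solving strategy $s$ and a cost budget $B$, $\mathrm{Eval}(F,s)$ denotes the cost of solving $F$ with strategy $s$, and $\mathrm{Check}(F,s,B)$ attempts to solve $F$ with $s$ under budget $B$: if $\mathrm{Eval}(F,s)\le B$ it returns the correct answer SAT or UNSAT, and otherwise it returns UNKNOWN. $\mathrm{Cube}(F,k)$ partitions $F$ into $k$ cubes. The procedure $\mathrm{Collect}(F,\mathcal{C},N,\mathcal{S})$ (parameters: $k>1$, minimal cost $c_{\min}$, maximal cost $c_{\max}$) works as follows: set $\mathcal{C}^*:=\emptyset$. While $|\mathcal{C}^*|<N$: pick some cube $c\in\mathcal{C}$ and some strategy $s\in\mathcal{S}$; let $r:=\mathrm{Check}(F\wedge c,s,c_{\max})$. If $r=$ SAT, return $\langle\mathrm{SAT},\emptyset\rangle$.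 Else if $r=$ UNSAT and $\mathrm{Eval}(F\wedge c,s)\ge c_{\min}$, set $\mathcal{C}^*:=\mathcal{C}^*\cup\{c\}$. Else if $r=$ UNKNOWN, set $\mathcal{C}:=\mathcal{C}\cup\{c'\wedge c : c'\in\mathrm{Cube}(F\wedge c,k)\}$. Then remove $c$ from $\mathcal{C}$; if $\mathcal{C}$ is empty, return $\langle\mathrm{UNSAT},\emptyset\rangle$. When the while loop exits, return $\langle\mathrm{UNKNOWN},\mathcal{C}^*\rangle$. *)

theory Defs
  imports Main
begin

text \<open>
  Quantifier-free formulas over arbitrary constraints \<open>'a\<close>. What a constraint means is given by
  a relation \<open>I m a\<close>: constraint \<open>a\<close> is true in the candidate model \<open>m\<close>. Propositional logic
  (\<open>I = (\<lambda>m a. m a)\<close>) and formulas modulo a theory are both instances.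
\<close>

datatype 'a form =
    Top
  | Bot
  | Atom 'a
  | Neg "'a form"
  | And "'a form" "'a form"
  | Or "'a form" "'a form"

primrec holds :: "('m \<Rightarrow> 'a \<Rightarrow> bool) \<Rightarrow> 'm \<Rightarrow> 'a form \<Rightarrow> bool" where
  "holds I m Top \<longleftrightarrow> True"
| "holds I m Bot \<longleftrightarrow> False"
| "holds I m (Atom a) \<longleftrightarrow> I m a"
| "holds I m (Neg F) \<longleftrightarrow> \<not> holds I m F"
| "holds I m (And F G) \<longleftrightarrow> holds I m F \<and> holds I m G"
| "holds I m (Or F G) \<longleftrightarrow> holds I m F \<or> holds I m G"

definition satisfiable :: "('m \<Rightarrow> 'a \<Rightarrow> bool) \<Rightarrow> 'a form \<Rightarrow> bool" where
  "satisfiable I F \<longleftrightarrow> (\<exists>m. holds I m F)"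

definition equisat :: "('m \<Rightarrow> 'a \<Rightarrow> bool) \<Rightarrow> 'a form \<Rightarrow> 'a form \<Rightarrow> bool" where
  "equisat I F G \<longleftrightarrow> (satisfiable I F \<longleftrightarrow> satisfiable I G)"

text \<open>The disjunction of a finite set of formulas, in some unspecified order; meaningless for
  infinite sets.\<close>

definition BigOr :: "'a form set \<Rightarrow> 'a form" where
  "BigOr A = foldr Or (SOME xs. set xs = A \<and> distinct xs) Bot"

lemma holds_BigOr:
  assumes "finite A"
  shows "holds I m (BigOr A) \<longleftrightarrow> (\<exists>F\<in>A. holds I m F)"
proof -
  have "holds I m (foldr Or xs Bot) \<longleftrightarrow> (\<exists>F\<in>set xs. holds I m F)" for xs
    by (induction xs) auto
  moreover have "set (SOME xs. set xs = A \<and> distinct xs) = A"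
    using someI_ex[OF finite_distinct_list[OF assms]] by blast
  ultimately show ?thesis
    by (simp add: BigOr_def)
qed

text \<open>
  Cubes are conjunctions of literals, kept as syntactic objects rather than as sets of literals:
  \<open>And c' c\<close> is always different from \<open>c\<close>. This matters for the procedure below, which first adds
  the refinements \<open>And c' c\<close> of a cube \<open>c\<close> and then removes \<open>c\<close>. If a refinement could coincide
  with \<open>c\<close> (as happens for sets of literals when the literals of \<open>c'\<close> all occur in \<open>c\<close>), it would
  be removed as well and an UNSAT answer could be wrong.
\<close>

inductive is_literal :: "'a form \<Rightarrow> bool" where
  "is_literal (Atom a)"
| "is_literal (Neg (Atom a))"

inductive is_cube :: "'a form \<Rightarrow> bool" where
  "is_cube Top"
| "is_literal l \<Longrightarrow> is_cube l"
| "is_cube c \<Longrightarrow> is_cube d \<Longrightarrow> is_cube (And c d)"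

text \<open>The cost type \<open>'c\<close> is any linear order, so that infinite costs (a strategy that
  never terminates) are possible.\<close>

datatype result = SAT | UNSAT | UNKNOWN

definition check ::
  "('m \<Rightarrow> 'a \<Rightarrow> bool) \<Rightarrow> ('a form \<Rightarrow> 's \<Rightarrow> 'c::linorder) \<Rightarrow> 'a form \<Rightarrow> 's \<Rightarrow> 'c \<Rightarrow> result" where
  "check I eval F s B =
     (if eval F s \<le> B then (if satisfiable I F then SAT else UNSAT) else UNKNOWN)"

text \<open>The exact number of cubes and their mutual exclusiveness are deliberately not imposed.\<close>

definition cube_procedure :: "('a form \<Rightarrow> nat \<Rightarrow> 'a form set) \<Rightarrow> bool" where
  "cube_procedure cube \<longleftrightarrow>
     (\<forall>G k. k > 1 \<longrightarrow> finite (cube G k) \<and> (\<forall>c\<in>cube G k. is_cube c))"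

definition cube_sound ::
  "('m \<Rightarrow> 'a \<Rightarrow> bool) \<Rightarrow> ('a form \<Rightarrow> nat \<Rightarrow> 'a form set) \<Rightarrow> bool" where
  "cube_sound I cube \<longleftrightarrow>
     (\<forall>G k. k > 1 \<longrightarrow> equisat I G (BigOr {And G c | c. c \<in> cube G k}))"

text \<open>
  Effect of one loop iteration on the pair of the current cubes \<open>C\<close> and the collected cubes \<open>D\<close>,
  for the chosen cube \<open>c\<close> and strategy \<open>s\<close>, when the check did not answer SAT.
\<close>

definition collect_update ::
  "('m \<Rightarrow> 'a \<Rightarrow> bool) \<Rightarrow> ('a form \<Rightarrow> 's \<Rightarrow> 'c::linorder) \<Rightarrow> ('a form \<Rightarrow> nat \<Rightarrow> 'a form set) \<Rightarrow>
   nat \<Rightarrow> 'c \<Rightarrow> 'c \<Rightarrow> 'a form \<Rightarrow> 'a form \<Rightarrow> 's \<Rightarrow>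
   'a form set \<times> 'a form set \<Rightarrow> 'a form set \<times> 'a form set" where
  "collect_update I eval cube k cmin cmax F c s = (\<lambda>(C, D).
     let r = check I eval (And F c) s cmax;
         (C', D') =
           (if r = UNSAT \<and> eval (And F c) s \<ge> cmin then (C, D \<union> {c})
            else if r = UNKNOWN then (C \<union> {And c' c | c'. c' \<in> cube (And F c) k}, D)
            else (C, D))
     in (C' - {c}, D'))"

text \<open>
  The choice of cube and strategy is nondeterministic and the loop need not terminate, so the
  loop is a relation: \<open>collect_loop \<dots> F N S C D out\<close> means that some run started with cubes \<open>C\<close>
  and collected cubes \<open>D\<close> returns \<open>out\<close>.
\<close>

inductive collect_loop ::
  "('m \<Rightarrow> 'a \<Rightarrow> bool) \<Rightarrow> ('a form \<Rightarrow> 's \<Rightarrow> 'c::linorder) \<Rightarrow> ('a form \<Rightarrow> nat \<Rightarrow> 'a form set) \<Rightarrow>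
   nat \<Rightarrow> 'c \<Rightarrow> 'c \<Rightarrow> 'a form \<Rightarrow> nat \<Rightarrow> 's set \<Rightarrow>
   'a form set \<Rightarrow> 'a form set \<Rightarrow> result \<times> 'a form set \<Rightarrow> bool"
  for I eval cube k cmin cmax F N S where
  exit: "\<not> card D < N \<Longrightarrow>
    collect_loop I eval cube k cmin cmax F N S C D (UNKNOWN, D)"
| return_sat: "\<lbrakk> card D < N; c \<in> C; s \<in> S; check I eval (And F c) s cmax = SAT \<rbrakk> \<Longrightarrow>
    collect_loop I eval cube k cmin cmax F N S C D (SAT, {})"
| return_unsat: "\<lbrakk> card D < N; c \<in> C; s \<in> S; check I eval (And F c) s cmax \<noteq> SAT;
      collect_update I eval cube k cmin cmax F c s (C, D) = (C', D'); C' = {} \<rbrakk> \<Longrightarrow>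
    collect_loop I eval cube k cmin cmax F N S C D (UNSAT, {})"
| continue: "\<lbrakk> card D < N; c \<in> C; s \<in> S; check I eval (And F c) s cmax \<noteq> SAT;
      collect_update I eval cube k cmin cmax F c s (C, D) = (C', D'); C' \<noteq> {};
      collect_loop I eval cube k cmin cmax F N S C' D' out \<rbrakk> \<Longrightarrow>
    collect_loop I eval cube k cmin cmax F N S C D out"

definition collect_returns ::
  "('m \<Rightarrow> 'a \<Rightarrow> bool) \<Rightarrow> ('a form \<Rightarrow> 's \<Rightarrow> 'c::linorder) \<Rightarrow> ('a form \<Rightarrow> nat \<Rightarrow> 'a form set) \<Rightarrow>
   nat \<Rightarrow> 'c \<Rightarrow> 'c \<Rightarrow> 'a form \<Rightarrow> 'a form set \<Rightarrow> nat \<Rightarrow> 's set \<Rightarrow>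
   result \<times> 'a form set \<Rightarrow> bool" where
  "collect_returns I eval cube k cmin cmax F C N S out \<longleftrightarrow>
     collect_loop I eval cube k cmin cmax F N S C {} out"

end

theory Submission
  imports Defs
begin

text \<open>
  For the UNSAT answer, the loop preserves the property that if \<open>F\<close> is satisfiable, then so is
  \<open>F \<and> c\<close> for some current cube \<open>c\<close>. A cube is dropped either because \<open>F \<and> c\<close> is unsatisfiable or
  after its refinements were added, and by soundness of \<open>cube\<close> one of them inherits satisfiability.
\<close>

lemma satisfiable_BigOr:
  assumes "finite A"
  shows "satisfiable I (BigOr A) \<longleftrightarrow> (\<exists>F\<in>A. satisfiable I F)"
  by (auto simp: satisfiable_def holds_BigOr[OF assms])

lemma satisfiable_BigOr_And:
  assumes "finite C"
  shows "satisfiable I (BigOr {And F c | c. c \<in> C}) \<longleftrightarrow> (\<exists>c\<in>C. satisfiable I (And F c))"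
  using assms by (auto simp: satisfiable_BigOr)

text \<open>Finiteness, from \<open>cube_procedure\<close>, lets \<open>BigOr\<close> be read as an
  existential, so equisatisfiability yields a single satisfiable branch.\<close>

lemma cube_refines:
  assumes "k > 1" "cube_procedure cube" "cube_sound I cube" "satisfiable I G"
  obtains c where "c \<in> cube G k" "satisfiable I (And G c)"
proof -
  have "finite (cube G k)"
    using assms(1,2) by (simp add: cube_procedure_def)
  moreover have "satisfiable I (BigOr {And G c | c. c \<in> cube G k})"
    using assms(1,3,4) unfolding cube_sound_def equisat_def by blast
  ultimately show thesis
    using that by (auto simp: satisfiable_BigOr_And)
qed

lemma collect_update_satisfiable:
  assumes "k > 1" "cube_procedure cube" "cube_sound I cube"
    and nsat: "check I eval (And F c) s cmax \<noteq> SAT"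
    and upd: "collect_update I eval cube k cmin cmax F c s (C, D) = (C', D')"
    and d: "d \<in> C" "satisfiable I (And F d)"
  shows "\<exists>d'\<in>C'. satisfiable I (And F d')"
proof (cases "d = c")
  case False
  then have "d \<in> C'"
    using upd d(1) by (auto simp: collect_update_def Let_def split: if_splits)
  then show ?thesis
    using d(2) by blast
next
  case True
  \<comment> \<open>A satisfiable \<open>And F c\<close> cannot be answered UNSAT, and SAT is
    excluded by assumption.\<close>
  then have "check I eval (And F c) s cmax = UNKNOWN"
    using nsat d(2) by (auto simp: check_def split: if_splits)
  then have C': "C' = C \<union> {And c' c | c'. c' \<in> cube (And F c) k} - {c}"
    using upd by (auto simp: collect_update_def)
  obtain c' where c': "c' \<in> cube (And F c) k" "satisfiable I (And (And F c) c')"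
    using cube_refines[OF assms(1-3)] d(2) True by blast
  \<comment> \<open>A conjunction is strictly larger than its conjunct, so removing \<open>c\<close>
    cannot delete this refinement.\<close>
  have "And c' c \<noteq> c"
    by (auto dest: arg_cong[where f = size])
  then have "And c' c \<in> C'"
    using c'(1) C' by auto
  moreover have "satisfiable I (And F (And c' c))"
    using c'(2) by (auto simp: satisfiable_def)
  ultimately show ?thesis
    by blast
qed

text \<open>No invariant on the cubes is involved: SAT arises only from a model of some
  \<open>And F c\<close>, which is also a model of \<open>F\<close>.\<close>

lemma collect_loop_SAT:
  assumes "collect_loop I eval cube k cmin cmax F N S C D out" "fst out = SAT"
  shows "satisfiable I F"
  using assms
  by (induction rule: collect_loop.induct)
    (auto simp: check_def satisfiable_def split: if_splits)

text \<open>A satisfiable \<open>And F d\<close> would leave a witness in every later set of cubes,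
  but the last one is empty. \<open>d\<close> is generalised in the induction since the witness may
  change at each iteration.\<close>

lemma collect_loop_UNSAT:
  assumes "collect_loop I eval cube k cmin cmax F N S C D out" "fst out = UNSAT"
    and "k > 1" "cube_procedure cube" "cube_sound I cube"
    and "d \<in> C"
  shows "\<not> satisfiable I (And F d)"
  using assms(1,2,6)
proof (induction arbitrary: d rule: collect_loop.induct)
  case (return_unsat D c C s C' D')
  then show ?case
    using collect_update_satisfiable[OF assms(3-5) return_unsat(4,5)] by blast
next
  case (continue D c C s C' D' out)
  then show ?case
    using collect_update_satisfiable[OF assms(3-5) continue(4,5)] by blast
\<comment> \<open>The two remaining rules return UNKNOWN or SAT, contradicting
  \<open>fst out = UNSAT\<close>.\<close>
qed auto

theorem theorem2:
  fixes I :: "'m \<Rightarrow> 'a \<Rightarrow> bool"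
    and eval :: "'a form \<Rightarrow> 's \<Rightarrow> 'c::linorder"
    and cube :: "'a form \<Rightarrow> nat \<Rightarrow> 'a form set"
    and k N :: nat
    and cmin cmax :: 'c
    and F :: "'a form"
    and S :: "'s set"
    and C :: "'a form set"
  assumes "k > 1"
    and "finite C"
    and "\<And>c. c \<in> C \<Longrightarrow> is_cube c"
    and "equisat I (BigOr {And F c | c. c \<in> C}) F"
    and "cube_procedure cube"
    and "cube_sound I cube"
  shows "(collect_returns I eval cube k cmin cmax F C N S (SAT, {}) \<longrightarrow> satisfiable I F) \<and>
         (collect_returns I eval cube k cmin cmax F C N S (UNSAT, {}) \<longrightarrow> \<not> satisfiable I F)"
proof (intro conjI impI)
  assume "collect_returns I eval cube k cmin cmax F C N S (SAT, {})"
  then show "satisfiable I F"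
    unfolding collect_returns_def by (rule collect_loop_SAT) simp
next
  assume "collect_returns I eval cube k cmin cmax F C N S (UNSAT, {})"
  then have "\<not> (\<exists>c\<in>C. satisfiable I (And F c))"
    using collect_loop_UNSAT[OF _ _ assms(1,5,6)] unfolding collect_returns_def by fastforce
  then show "\<not> satisfiable I F"
    using assms(4) satisfiable_BigOr_And[OF assms(2)] by (auto simp: equisat_def)
qed

end
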